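(* Let $F_{n,4}$ be the graph consisting of $n$ cycles of order $4$ meeting at one common vertex, and let $D_t(F_{n,4},x)$ be its total domination polynomial. Then: (i) for every even natural number $n\geq 2$, $D_t(F_{n,4},x)$ has a real root in the open interval $(-1,0)$; (ii) for all sufficiently large $n$, $D_t(F_{n,4},x)$ has a real root in the open interval $(-n,-\ln(n))$.
   Context: All graphs are finite and simple. A set $D\subseteq V$ is a total dominating set of a graph $G=(V,E)$ if every vertex of $V$ (including those in $D$) is adjacent to some vertex of $D$. Let $d_t(G,i)$ be the number of total dominating sets of $G$ of cardinality $i$. The total domination polynomial of a graph $G$ of order $N$ is $D_t(G,x)=\sum_{i=1}^{N} d_t(G,i)x^i$. The generalized friendship graph $F_{n,4}$ is the union of $n$ cycles of length $4$ that all share one common vertex and are otherwise vertex-disjoint; it has $3n+1$ vertices. *)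

theory Defs
  imports Complex_Main "HOL-Computational_Algebra.Polynomial"
begin

record 'a graph =
  verts :: "'a set"
  edges :: "'a set set"

definition finite_simple_graph :: "'a graph \<Rightarrow> bool" where
  "finite_simple_graph G \<longleftrightarrow>
     finite (verts G) \<and> (\<forall>e\<in>edges G. e \<subseteq> verts G \<and> card e = 2)"

definition adjacent :: "'a graph \<Rightarrow> 'a \<Rightarrow> 'a \<Rightarrow> bool" where
  "adjacent G u v \<longleftrightarrow> {u, v} \<in> edges G"

definition total_dominating_set :: "'a graph \<Rightarrow> 'a set \<Rightarrow> bool" where
  "total_dominating_set G D \<longleftrightarrow>
     D \<subseteq> verts G \<and> (\<forall>v\<in>verts G. \<exists>u\<in>D. adjacent G v u)"

definition num_tds :: "'a graph \<Rightarrow> nat \<Rightarrow> nat" where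
  "num_tds G i = card {D. total_dominating_set G D \<and> card D = i}"

definition total_domination_poly :: "'a graph \<Rightarrow> real poly" where
  "total_domination_poly G = (\<Sum>i=1..card (verts G). monom (of_nat (num_tds G i)) i)"

text \<open>The cycle through the vertices of a list in the given order; this is a simple
  cycle only if the list is distinct and has length at least 3.\<close>

definition cycle_graph :: "'a list \<Rightarrow> 'a graph" where
  "cycle_graph vs =
     \<lparr>verts = set vs,
      edges = {{vs ! j, vs ! (Suc j mod length vs)} | j. j < length vs}\<rparr>"

definition graph_Union :: "'a graph set \<Rightarrow> 'a graph" where
  "graph_Union \<G> = \<lparr>verts = (\<Union>G\<in>\<G>. verts G), edges = (\<Union>G\<in>\<G>. edges G)\<rparr>"

datatype friendship_vertex = Center | Outer nat nat

text \<open>\<open>petal q i\<close> is the \<open>i\<close>-th cycle of order \<open>q\<close>: it visits \<open>Center\<close> and then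
  the \<open>q - 1\<close> vertices \<open>Outer i 1, \<dots>, Outer i (q - 1)\<close> that belong to no other petal.\<close>

definition petal :: "nat \<Rightarrow> nat \<Rightarrow> friendship_vertex graph" where
  "petal q i = cycle_graph (Center # map (Outer i) [1..<q])"

definition friendship_graph :: "nat \<Rightarrow> nat \<Rightarrow> friendship_vertex graph" where
  "friendship_graph n q = graph_Union (petal q ` {..<n})"

lemma petal_4: "petal 4 i = cycle_graph [Center, Outer i 1, Outer i 2, Outer i 3]"
proof -
  have "[1..<4] = [1, 2, 3::nat]"
    by (simp add: numeral_eq_Suc)
  then show ?thesis
    by (simp only: petal_def list.map)
qed

lemma verts_petal: "verts (petal 4 i) = {Center, Outer i 1, Outer i 2, Outer i 3}"
  by (simp add: petal_4 cycle_graph_def)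

lemma edges_petal:
  "edges (petal 4 i) =
     {{Center, Outer i 1}, {Outer i 1, Outer i 2}, {Outer i 2, Outer i 3}, {Outer i 3, Center}}"
proof -
  define vs where "vs = [Center, Outer i 1, Outer i 2, Outer i 3]"
  have len: "length vs = 4"
    by (simp add: vs_def)
  have "edges (petal 4 i) = (\<lambda>j. {vs ! j, vs ! (Suc j mod 4)}) ` {j. j < 4}"
    unfolding petal_4 vs_def[symmetric] cycle_graph_def len by auto
  also have "{j. j < 4} = {0, 1, 2, 3::nat}"
    by auto
  finally show ?thesis
    by (simp add: vs_def)
qed

lemma verts_petal_Int:
  "i \<noteq> j \<Longrightarrow> verts (petal 4 i) \<inter> verts (petal 4 j) = {Center}"
  by (auto simp: verts_petal)

lemma finite_simple_friendship_graph: "finite_simple_graph (friendship_graph n 4)"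
  unfolding finite_simple_graph_def friendship_graph_def graph_Union_def
  by (auto simp: verts_petal edges_petal)

lemma card_verts_friendship_graph:
  assumes "n \<ge> 1"
  shows "card (verts (friendship_graph n 4)) = 3 * n + 1"
proof -
  define S where "S = case_prod Outer ` ({..<n} \<times> {1, 2, 3})"
  have "v \<in> verts (friendship_graph n 4) \<longleftrightarrow> v \<in> insert Center S" for v
  proof (cases v)
    case Center
    have "0 < n"
      using assms by simp
    then show ?thesis
      by (auto simp: friendship_graph_def graph_Union_def verts_petal Center)
  next
    case (Outer i j)
    then show ?thesis
      by (auto simp: friendship_graph_def graph_Union_def verts_petal S_def image_iff)
  qed
  then have "verts (friendship_graph n 4) = insert Center S"
    by blast
  moreover have "card S = card ({..<n} \<times> {1, 2, 3::nat})"
    unfolding S_def by (rule card_image) (auto intro: inj_onI)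
  moreover have "finite S" "Center \<notin> S"
    by (auto simp: S_def)
  ultimately show ?thesis
    by (simp add: card_cartesian_product)
qed

end

theory Submission
  imports Defs "HOL-Library.FuncSet" "HOL-Real_Asymp.Real_Asymp"
begin

text \<open>
  The total domination polynomial of \<open>F\<^bsub>n,4\<^esub>\<close> has a closed form. In the petal
  \<open>Center, Outer i 1, Outer i 2, Outer i 3\<close> the vertex \<open>Outer i 2\<close> forces one of \<open>Outer i 1\<close>,
  \<open>Outer i 3\<close> into a total dominating set \<open>D\<close>, and each of these two forces \<open>Center\<close> or
  \<open>Outer i 2\<close>; as soon as there is a petal, \<open>Center\<close> is then dominated as well. So once it is
  decided whether \<open>Center \<in> D\<close>, the petals can be filled independently of one another, and the
  generating function of each of the two cases is an \<open>n\<close>-th power. This gives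
  \<open>D\<^sub>t(x) = x^(n+1) (x+2)^n ((1+x)^n + x^(n-1))\<close> (\<open>poly_total_domination_friendship_graph\<close>).

  Both claims are sign changes of the last factor. For even \<open>n\<close> it is \<open>-1\<close> at \<open>x = -1\<close> and
  \<open>1\<close> at \<open>x = 0\<close>. At \<open>x = -y\<close> it is, up to sign, \<open>(y-1)^n - y^(n-1)\<close>. The sign of this
  expression tells whether \<open>y (1 - 1/y)^n\<close> exceeds \<open>1\<close>. At \<open>y = ln n\<close> that quantity is at most
  \<open>ln n exp (-n / ln n)\<close>, which tends to \<open>0\<close>, whereas at \<open>y = n\<close> it is about \<open>n/e\<close>.
\<close>

section \<open>The polynomial as a generating function\<close>

lemma finite_total_dominating_sets:
  assumes "finite (verts G)"
  shows "finite {D. total_dominating_set G D}"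
  by (rule finite_subset[of _ "Pow (verts G)"]) (use assms in \<open>auto simp: total_dominating_set_def\<close>)

text \<open>The polynomial has no constant term, but neither has the generating function: the empty set
  dominates nothing.\<close>

lemma poly_total_domination_poly:
  assumes fin: "finite (verts G)" and ne: "verts G \<noteq> {}"
  shows "poly (total_domination_poly G) x = (\<Sum>D | total_dominating_set G D. x ^ card D)"
proof -
  let ?T = "{D. total_dominating_set G D}"
  have range: "card ` ?T \<subseteq> {1..card (verts G)}"
  proof clarify
    fix D assume D: "total_dominating_set G D"
    then have sub: "D \<subseteq> verts G" and "D \<noteq> {}"
      using ne by (auto simp: total_dominating_set_def)
    then show "card D \<in> {1..card (verts G)}"
      using fin card_mono[OF fin sub] finite_subset[OF sub fin] by (auto simp: Suc_le_eq card_gt_0_iff)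
  qed
  have "poly (total_domination_poly G) x = (\<Sum>i=1..card (verts G). real (num_tds G i) * x ^ i)"
    by (simp add: total_domination_poly_def poly_sum poly_monom)
  also have "\<dots> = (\<Sum>i=1..card (verts G). \<Sum>D | D \<in> ?T \<and> card D = i. x ^ card D)"
    by (rule sum.cong) (simp_all add: num_tds_def)
  also have "\<dots> = (\<Sum>D\<in>?T. x ^ card D)"
    by (rule sum.group) (use finite_total_dominating_sets[OF fin] range in auto)
  finally show ?thesis .
qed

section \<open>Total dominating sets of the friendship graph\<close>

lemma verts_friendship_graph:
  assumes "n \<ge> 1"
  shows "verts (friendship_graph n 4) = insert Center (\<Union>i<n. Outer i ` {1, 2, 3})"
proof -
  have "0 \<in> {..<n}"
    using assms by simp
  then show ?thesis
    by (auto simp: friendship_graph_def graph_Union_def verts_petal)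
qed

lemma edges_friendship_graph:
  "edges (friendship_graph n 4) =
     (\<Union>i<n. {{Center, Outer i 1}, {Outer i 1, Outer i 2}, {Outer i 2, Outer i 3}, {Outer i 3, Center}})"
  by (simp add: friendship_graph_def graph_Union_def edges_petal)

definition fibre :: "friendship_vertex set \<Rightarrow> nat \<Rightarrow> nat set" where
  "fibre D i = {j. Outer i j \<in> D}"

definition glue :: "nat \<Rightarrow> (nat \<Rightarrow> nat set) \<Rightarrow> friendship_vertex set" where
  "glue n p = (\<Union>i<n. Outer i ` p i)"

lemma Center_notin_glue [simp]: "Center \<notin> glue n p"
  by (auto simp: glue_def)

lemma fibre_insert_Center [simp]: "fibre (insert Center D) = fibre D"
  by (auto simp: fibre_def)

lemma fibre_glue: "i < n \<Longrightarrow> fibre (glue n p) i = p i"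
  by (auto simp: fibre_def glue_def)

lemma glue_restrict_fibre:
  assumes "D \<subseteq> verts (friendship_graph n 4)" "n \<ge> 1"
  shows "glue n (restrict (fibre D) {..<n}) = D - {Center}"
  using assms by (auto simp: verts_friendship_graph glue_def fibre_def)

text \<open>These are the traces that a total dominating set containing \<open>Center\<close> can leave on a petal.
  Without \<open>Center\<close>, the vertices \<open>Outer i 1\<close> and \<open>Outer i 3\<close> have only \<open>Outer i 2\<close> left to dominate
  them.\<close>

definition petal_choices :: "nat set set" where
  "petal_choices = {S. S \<subseteq> {1, 2, 3} \<and> (1 \<in> S \<or> 3 \<in> S)}"

definition petal_choices_no_center :: "nat set set" where
  "petal_choices_no_center = {S \<in> petal_choices. 2 \<in> S}"

lemma adjacent_friendship_graph_simps:
  "adjacent (friendship_graph n 4) Center u \<longleftrightarrow> (\<exists>i<n. u = Outer i 1 \<or> u = Outer i 3)"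
  "adjacent (friendship_graph n 4) (Outer i 1) u \<longleftrightarrow> i < n \<and> (u = Center \<or> u = Outer i 2)"
  "adjacent (friendship_graph n 4) (Outer i 2) u \<longleftrightarrow> i < n \<and> (u = Outer i 1 \<or> u = Outer i 3)"
  "adjacent (friendship_graph n 4) (Outer i 3) u \<longleftrightarrow> i < n \<and> (u = Center \<or> u = Outer i 2)"
  by (auto simp: adjacent_def edges_friendship_graph doubleton_eq_iff)

text \<open>Total domination is a condition on each petal separately, given whether \<open>Center\<close> is chosen.
  The demand of \<open>Center\<close> itself disappears because any single petal meets it.\<close>

lemma total_dominating_set_friendship_graph_iff:
  assumes "n \<ge> 1"
  shows "total_dominating_set (friendship_graph n 4) D \<longleftrightarrow>
    D \<subseteq> verts (friendship_graph n 4) \<and>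
    (\<forall>i<n. fibre D i \<in> (if Center \<in> D then petal_choices else petal_choices_no_center))"
proof (cases "D \<subseteq> verts (friendship_graph n 4)")
  case True
  then have sub: "fibre D i \<subseteq> {1, 2, 3}" for i
    using assms by (auto simp: verts_friendship_graph fibre_def)
  have "total_dominating_set (friendship_graph n 4) D \<longleftrightarrow>
    (\<exists>i<n. 1 \<in> fibre D i \<or> 3 \<in> fibre D i) \<and>
    (\<forall>i<n. (Center \<in> D \<or> 2 \<in> fibre D i) \<and> (1 \<in> fibre D i \<or> 3 \<in> fibre D i))"
    using True assms unfolding total_dominating_set_def
    by (simp add: verts_friendship_graph adjacent_friendship_graph_simps ball_UN fibre_def
          del: One_nat_def) blast
  also have "\<dots> \<longleftrightarrow> (\<forall>i<n. (Center \<in> D \<or> 2 \<in> fibre D i) \<and> (1 \<in> fibre D i \<or> 3 \<in> fibre D i))"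
    using assms by (metis less_le_trans zero_less_one)
  finally show ?thesis
    using True sub by (auto simp: petal_choices_def petal_choices_no_center_def)
qed (simp add: total_dominating_set_def)

section \<open>The closed form\<close>

lemma card_glue:
  assumes "\<And>i. i < n \<Longrightarrow> finite (p i)"
  shows "card (glue n p) = (\<Sum>i<n. card (p i))"
proof -
  have "card (glue n p) = (\<Sum>i<n. card (Outer i ` p i))"
    unfolding glue_def by (rule card_UN_disjoint) (use assms in auto)
  also have "\<dots> = (\<Sum>i<n. card (p i))"
    by (intro sum.cong card_image) (auto simp: inj_on_def)
  finally show ?thesis .
qed

text \<open>The parts put into different petals are disjoint, so a choice for all petals weighs the
  product of the weights of its parts; as the choices are independent, the sum of these products
  factors.\<close>

lemma sum_power_card_glue:
  fixes x :: real
  assumes "finite A" "\<And>S. S \<in> A \<Longrightarrow> finite S"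
  shows "(\<Sum>p\<in>{..<n} \<rightarrow>\<^sub>E A. x ^ card (glue n p)) = (\<Sum>S\<in>A. x ^ card S) ^ n"
proof -
  have "(\<Sum>p\<in>{..<n} \<rightarrow>\<^sub>E A. x ^ card (glue n p)) = (\<Sum>p\<in>{..<n} \<rightarrow>\<^sub>E A. \<Prod>i<n. x ^ card (p i))"
    by (intro sum.cong refl, subst card_glue) (use assms in \<open>auto simp: power_sum\<close>)
  also have "\<dots> = (\<Prod>i<n. \<Sum>S\<in>A. x ^ card S)"
    using assms(1) by (subst prod_sum_PiE) auto
  finally show ?thesis by simp
qed

lemma petal_choices_eq: "petal_choices = {{1}, {3}, {1, 3}, {1, 2}, {2, 3}, {1, 2, 3}}"
proof -
  have "petal_choices = {S \<in> Pow {1, 2, 3}. 1 \<in> S \<or> 3 \<in> S}"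
    by (auto simp: petal_choices_def)
  also have "\<dots> = {{1}, {3}, {1, 3}, {1, 2}, {2, 3}, {1, 2, 3}}"
    unfolding Pow_insert Pow_empty by (auto simp del: One_nat_def)
  finally show ?thesis .
qed

lemma petal_choices_no_center_eq: "petal_choices_no_center = {{1, 2}, {2, 3}, {1, 2, 3}}"
  unfolding petal_choices_no_center_def petal_choices_eq by (auto simp del: One_nat_def)

lemma sum_petal_choices: "(\<Sum>S\<in>petal_choices. x ^ card S) = x * (1 + x) * (x + 2)" for x :: real
proof -
  let ?L = "[{1}, {3}, {1, 3}, {1, 2}, {2, 3}, {1, 2, 3 :: nat}]"
  have "distinct ?L"
    by (simp add: set_eq_iff) presburger
  moreover have "petal_choices = set ?L"
    by (simp add: petal_choices_eq)
  ultimately have "(\<Sum>S\<in>petal_choices. x ^ card S) = (\<Sum>S\<leftarrow>?L. x ^ card S)"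
    using sum.distinct_set_conv_list[of ?L "\<lambda>S. x ^ card S"] by (simp only:)
  also have "\<dots> = x + x + x^2 + x^2 + x^2 + x^3"
    by (simp add: power2_eq_square power3_eq_cube)
  finally show ?thesis
    by (simp add: algebra_simps power2_eq_square power3_eq_cube)
qed

lemma sum_petal_choices_no_center:
  "(\<Sum>S\<in>petal_choices_no_center. x ^ card S) = x^2 * (x + 2)" for x :: real
proof -
  let ?L = "[{1, 2}, {2, 3}, {1, 2, 3 :: nat}]"
  have "distinct ?L"
    by (simp add: set_eq_iff) presburger
  moreover have "petal_choices_no_center = set ?L"
    by (simp add: petal_choices_no_center_eq)
  ultimately have "(\<Sum>S\<in>petal_choices_no_center. x ^ card S) = (\<Sum>S\<leftarrow>?L. x ^ card S)"
    using sum.distinct_set_conv_list[of ?L "\<lambda>S. x ^ card S"] by (simp only:)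
  also have "\<dots> = x^2 + x^2 + x^3"
    by (simp add: power2_eq_square power3_eq_cube)
  finally show ?thesis
    by (simp add: algebra_simps power2_eq_square power3_eq_cube)
qed

lemma finite_petal_choices:
  "finite petal_choices" "finite petal_choices_no_center"
  "S \<in> petal_choices \<Longrightarrow> finite S" "S \<in> petal_choices_no_center \<Longrightarrow> finite S"
  by (auto simp: petal_choices_eq petal_choices_no_center_eq)

lemma glue_subset_verts:
  assumes "n \<ge> 1" "p \<in> {..<n} \<rightarrow>\<^sub>E petal_choices"
  shows "glue n p \<subseteq> verts (friendship_graph n 4)"
proof -
  have "p i \<subseteq> {1, 2, 3}" if "i < n" for i
    using assms(2) that by (auto simp: petal_choices_def PiE_iff)
  then show ?thesis
    using assms(1) by (fastforce simp: verts_friendship_graph glue_def)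
qed

theorem poly_total_domination_friendship_graph:
  assumes n: "n \<ge> 1"
  shows "poly (total_domination_poly (friendship_graph n 4)) x =
    x ^ (n + 1) * (x + 2) ^ n * ((1 + x) ^ n + x ^ (n - 1))"
proof -
  let ?G = "friendship_graph n 4"
  let ?T = "{D. total_dominating_set ?G D}"
  let ?P = "{..<n} \<rightarrow>\<^sub>E petal_choices" and ?Q = "{..<n} \<rightarrow>\<^sub>E petal_choices_no_center"
  have fin: "finite (verts ?G)"
    using finite_simple_friendship_graph by (auto simp: finite_simple_graph_def)
  have finT: "finite ?T"
    using fin by (rule finite_total_dominating_sets)
  note iff = total_dominating_set_friendship_graph_iff[OF n]
  have QP: "?Q \<subseteq> ?P"
    by (rule PiE_mono) (auto simp: petal_choices_no_center_def)
  have fin_glue: "finite (glue n p)" if "p \<in> ?P" for p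
    using glue_subset_verts[OF n that] fin by (rule finite_subset)
  have restrict_eq: "restrict (fibre (glue n p)) {..<n} = p" if "p \<in> ?P" for p
    using that by (auto simp: fun_eq_iff restrict_def fibre_glue PiE_iff extensional_def)
  have center: "(\<Sum>D | D \<in> ?T \<and> Center \<in> D. x ^ card D) = (\<Sum>p\<in>?P. x * x ^ card (glue n p))"
  proof (rule sum.reindex_bij_witness[where i = "\<lambda>p. insert Center (glue n p)" and
        j = "\<lambda>D. restrict (fibre D) {..<n}"])
    fix D assume "D \<in> {D. D \<in> ?T \<and> Center \<in> D}"
    then have D: "D \<subseteq> verts ?G" "Center \<in> D" "\<forall>i<n. fibre D i \<in> petal_choices"
      by (auto simp: iff)
    show eq: "insert Center (glue n (restrict (fibre D) {..<n})) = D"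
      using D n by (auto simp: glue_restrict_fibre)
    show mem: "restrict (fibre D) {..<n} \<in> ?P"
      using D by auto
    have "card D = Suc (card (glue n (restrict (fibre D) {..<n})))"
      by (subst eq[symmetric]) (use fin_glue[OF mem] in simp)
    then show "x * x ^ card (glue n (restrict (fibre D) {..<n})) = x ^ card D"
      by simp
  next
    fix p assume p: "p \<in> ?P"
    show "restrict (fibre (insert Center (glue n p))) {..<n} = p"
      using restrict_eq[OF p] by simp
    show "insert Center (glue n p) \<in> {D. D \<in> ?T \<and> Center \<in> D}"
      using p glue_subset_verts[OF n p] n by (auto simp: iff fibre_glue PiE_iff verts_friendship_graph)
  qed
  have no_center: "(\<Sum>D | D \<in> ?T \<and> Center \<notin> D. x ^ card D) = (\<Sum>p\<in>?Q. x ^ card (glue n p))"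
  proof (rule sum.reindex_bij_witness[where i = "glue n" and j = "\<lambda>D. restrict (fibre D) {..<n}"])
    fix D assume "D \<in> {D. D \<in> ?T \<and> Center \<notin> D}"
    then have D: "D \<subseteq> verts ?G" "Center \<notin> D" "\<forall>i<n. fibre D i \<in> petal_choices_no_center"
      by (auto simp: iff)
    show eq: "glue n (restrict (fibre D) {..<n}) = D"
      using D n by (simp add: glue_restrict_fibre)
    show "restrict (fibre D) {..<n} \<in> ?Q"
      using D by auto
    show "x ^ card (glue n (restrict (fibre D) {..<n})) = x ^ card D"
      by (simp add: eq)
  next
    fix p assume p: "p \<in> ?Q"
    show "restrict (fibre (glue n p)) {..<n} = p"
      using p QP by (intro restrict_eq) auto
    show "glue n p \<in> {D. D \<in> ?T \<and> Center \<notin> D}"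
    proof -
      have "glue n p \<subseteq> verts ?G"
        using p QP by (intro glue_subset_verts n) auto
      then show ?thesis
        using p by (auto simp: iff fibre_glue PiE_iff)
    qed
  qed
  have "poly (total_domination_poly ?G) x = (\<Sum>D\<in>?T. x ^ card D)"
    using fin n by (intro poly_total_domination_poly) (simp_all add: verts_friendship_graph)
  also have "\<dots> = (\<Sum>D | D \<in> ?T \<and> Center \<in> D. x ^ card D) + (\<Sum>D | D \<in> ?T \<and> Center \<notin> D. x ^ card D)"
    by (subst sum.union_disjoint[symmetric]) (use finT in \<open>auto intro!: sum.cong\<close>)
  also have "\<dots> = x * (x * (1 + x) * (x + 2)) ^ n + (x^2 * (x + 2)) ^ n"
    unfolding center no_center
    by (simp add: sum_distrib_left[symmetric] sum_power_card_glue finite_petal_choices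
          sum_petal_choices sum_petal_choices_no_center)
  also have "\<dots> = x * (x ^ n * (1 + x) ^ n * (x + 2) ^ n) + x ^ n * x ^ n * (x + 2) ^ n"
    by (simp only: power_mult_distrib power2_eq_square)
  also have "\<dots> = x ^ (n + 1) * (x + 2) ^ n * ((1 + x) ^ n + x ^ (n - 1))"
    using n by (cases n) (simp_all add: algebra_simps)
  finally show ?thesis .
qed

section \<open>Sign changes\<close>

lemma root_if_sign_change:
  fixes f :: "real \<Rightarrow> real"
  assumes "f a < 0" "0 < f b" "a < b" "continuous_on {a..b} f"
  obtains x where "a < x" "x < b" "f x = 0"
  using IVT'[of f a 0 b] assms by (metis less_eq_real_def order_less_irrefl)

lemma root_in_unit_interval:
  assumes "n \<ge> 2" "even n"
  obtains x :: real where "-1 < x" "x < 0" "(1 + x) ^ n + x ^ (n - 1) = 0"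
  by (rule root_if_sign_change[of "\<lambda>x. (1 + x) ^ n + x ^ (n - 1)" "-1" "0 :: real"])
     (use assms in \<open>auto simp: power_0_left intro!: continuous_intros\<close>)

text \<open>At \<open>y = n\<close> the comparison is \<open>(1 + 1/m)^m < m\<close> with \<open>m = n - 1\<close>, which follows from
  \<open>(1 + 1/m)^m \<le> e \<le> 3\<close>.\<close>

lemma power_pred_less_pred_power:
  assumes "n \<ge> 5"
  shows "real n ^ (n - 1) < (real n - 1) ^ n"
proof -
  obtain m where m: "n = Suc m" "m \<ge> 4"
    using assms by (cases n) auto
  have "(1 + 1 / real m) ^ m \<le> exp (1 / real m) ^ m"
    by (intro power_mono exp_ge_add_one_self) auto
  also have "\<dots> = exp (1 :: real)"
    using m by (simp add: exp_of_nat_mult[symmetric])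
  also have "\<dots> < real m"
    using exp_le m by simp
  finally have "real m ^ m * (1 + 1 / real m) ^ m < real m ^ m * real m"
    using m by (intro mult_strict_left_mono) auto
  also have "real m ^ m * (1 + 1 / real m) ^ m = (real m + 1) ^ m"
    using m by (simp add: power_mult_distrib[symmetric] distrib_left)
  finally show ?thesis
    using m by (simp add: algebra_simps)
qed

lemma pred_power_less_power_pred:
  fixes y :: real
  assumes y: "y \<ge> 1" and n: "n \<ge> 1" and small: "y * exp (- real n / y) < 1"
  shows "(y - 1) ^ n < y ^ (n - 1)"
proof -
  have "(1 - 1 / y) ^ n \<le> exp (- 1 / y) ^ n"
    using exp_ge_add_one_self[of "- 1 / y"] y by (intro power_mono) auto
  also have "\<dots> = exp (- real n / y)"
    by (simp add: exp_of_nat_mult[symmetric])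
  finally have "(1 - 1 / y) ^ n \<le> exp (- real n / y)" .
  then have "y * (1 - 1 / y) ^ n \<le> y * exp (- real n / y)"
    using y by (intro mult_left_mono) auto
  also have "\<dots> < 1"
    by (rule small)
  finally have "y ^ (n - 1) * (y * (1 - 1 / y) ^ n) < y ^ (n - 1) * 1"
    using y by (intro mult_strict_left_mono) auto
  also have "y ^ (n - 1) * (y * (1 - 1 / y) ^ n) = (y * (1 - 1 / y)) ^ n"
    using n by (cases n) (simp_all add: power_mult_distrib mult_ac)
  also have "y * (1 - 1 / y) = y - 1"
    using y by (simp add: field_simps)
  finally show ?thesis by simp
qed

lemma root_below_minus_ln:
  "\<exists>n0. \<forall>n\<ge>n0. \<exists>x. - real n < x \<and> x < - ln (real n) \<and> (1 + x) ^ n + x ^ (n - 1) = 0"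
proof -
  have "eventually (\<lambda>n. ln (real n) * exp (- real n / ln (real n)) < 1) at_top"
    by real_asymp
  moreover have "eventually (\<lambda>n. ln (real n) \<ge> 1) at_top"
    by real_asymp
  ultimately have "eventually (\<lambda>n. n \<ge> 5 \<and> ln (real n) \<ge> 1 \<and>
      ln (real n) * exp (- real n / ln (real n)) < 1) at_top"
    using eventually_ge_at_top[of 5] by eventually_elim auto
  then obtain n0 where n0: "\<And>n. n \<ge> n0 \<Longrightarrow> n \<ge> 5 \<and> ln (real n) \<ge> 1 \<and>
      ln (real n) * exp (- real n / ln (real n)) < 1"
    by (auto simp: eventually_at_top_linorder)
  have "\<exists>x. - real n < x \<and> x < - ln (real n) \<and> (1 + x) ^ n + x ^ (n - 1) = 0" if "n \<ge> n0" for n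
  proof -
    let ?f = "\<lambda>y :: real. (y - 1) ^ n - y ^ (n - 1)"
    have n: "n \<ge> 5" "ln (real n) \<ge> 1" "ln (real n) * exp (- real n / ln (real n)) < 1"
      using n0[OF that] by auto
    obtain y where y: "ln (real n) < y" "y < real n" "?f y = 0"
    proof (rule root_if_sign_change[of ?f "ln (real n)" "real n"])
      show "?f (ln (real n)) < 0"
        using n pred_power_less_power_pred[of "ln (real n)" n] by simp
      show "0 < ?f (real n)"
        using power_pred_less_pred_power n by simp
      show "ln (real n) < real n"
        using n by (intro ln_less_self) simp
    qed (auto intro!: continuous_intros)
    obtain m where m: "n = Suc m"
      using n by (cases n) auto
    have "(1 - y) ^ n + (- y) ^ (n - 1) = (- 1) ^ n * ?f y"
      using power_minus[of "y - 1" n] power_minus[of y m] by (simp add: m algebra_simps)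
    then show ?thesis
      using y by (intro exI[of _ "- y"]) simp
  qed
  then show ?thesis by blast
qed

section \<open>Real roots of the total domination polynomial\<close>

theorem theorem2p12:
  shows "(\<forall>n::nat. n \<ge> 2 \<and> even n \<longrightarrow>
            (\<exists>x\<in>{-1<..<0}. poly (total_domination_poly (friendship_graph n 4)) x = 0)) \<and>
         (\<exists>n0::nat. \<forall>n\<ge>n0.
            \<exists>x\<in>{- real n<..<- ln (real n)}. poly (total_domination_poly (friendship_graph n 4)) x = 0)"
proof (intro conjI allI impI)
  fix n :: nat
  assume n: "n \<ge> 2 \<and> even n"
  then obtain x :: real where x: "-1 < x" "x < 0" "(1 + x) ^ n + x ^ (n - 1) = 0"
    using root_in_unit_interval by blast
  then show "\<exists>x\<in>{-1<..<0}. poly (total_domination_poly (friendship_graph n 4)) x = 0"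
    using n by (intro bexI[of _ x]) (simp_all add: poly_total_domination_friendship_graph)
next
  obtain n0 where n0: "\<And>n. n \<ge> n0 \<Longrightarrow>
      \<exists>x. - real n < x \<and> x < - ln (real n) \<and> (1 + x) ^ n + x ^ (n - 1) = 0"
    using root_below_minus_ln by blast
  have "\<exists>x\<in>{- real n<..<- ln (real n)}. poly (total_domination_poly (friendship_graph n 4)) x = 0"
    if n: "n \<ge> max n0 1" for n
  proof -
    obtain x where x: "- real n < x" "x < - ln (real n)" "(1 + x) ^ n + x ^ (n - 1) = 0"
      using n0[of n] n by auto
    then show ?thesis
      using n by (intro bexI[of _ x]) (simp_all add: poly_total_domination_friendship_graph)
  qed
  then show "\<exists>n0::nat. \<forall>n\<ge>n0.
      \<exists>x\<in>{- real n<..<- ln (real n)}. poly (total_domination_poly (friendship_graph n 4)) x = 0"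
    by blast
qed

end
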